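(* Let $(A,\mu,\alpha,\beta)$ be a multiplicative regular BiHom-alternative algebra over a field of characteristic $0$, and define the BiHom-commutator $$[x,y]:=\mu(x,y)-\mu(\alpha^{-1}\beta(y),\alpha\beta^{-1}(x)),\qquad x,y\in A,$$ which is the binary operation of the BiHom-Akivis algebra associated with $(A,\mu,\alpha,\beta)$. Then $(A,[-,-],\alpha,\beta)$ is a BiHom-Malcev algebra.
   Context: All vector spaces are over a field $\mathbb{K}$ of characteristic $0$. A BiHom-algebra is a quadruple $(A,\mu,\alpha,\beta)$ where $A$ is a vector space, $\mu:A\otimes A\to A$, $\alpha,\beta:A\to A$ are linear maps, and $\alpha\beta=\beta\alpha$. It is regular if $\alpha,\beta$ are bijective, and multiplicative if $\alpha\circ\mu=\mu\circ\alpha^{\otimes 2}$ and $\beta\circ\mu=\mu\circ\beta^{\otimes 2}$. The BiHom-associator is $as_{\alpha,\beta}(x,y,z)=\mu(\mu(x,y),\beta(z))-\mu(\alpha(x),\mu(y,z))$. The BiHom-algebra is BiHom-alternative if for all $x,y,z\in A$ one has $as_{\alpha,\beta}(\beta(x),\alpha(y),z)+as_{\alpha,\beta}(\beta(y),\alpha(x),z)=0$ and $as_{\alpha,\beta}(x,\beta(y),\alpha(z))+as_{\alpha,\beta}(x,\beta(z),\alpha(y))=0$. For a BiHom-algebra $(A,[-,-],\alpha,\beta)$, the BiHom-Jacobiator is $J_{\alpha,\beta}(x,y,z)=\sum_{\mathrm{cyc}}[\beta^2(x),[\beta(y),\alpha(z)]]$, the sum being over the three cyclic permutations of $(x,y,z)$.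 $(A,[-,-],\alpha,\beta)$ is a BiHom-Malcev algebra if for all $x,y,z\in A$: (a) $[\beta(x),\alpha(y)]=-[\beta(y),\alpha(x)]$; (b) $J_{\alpha,\beta}(\alpha\beta(x),\alpha\beta(y),[\beta(x),\alpha(z)])=[J_{\alpha,\beta}(\beta(x),\beta(y),\beta(z)),\alpha^2\beta^2(x)]$. *)

theory Defs
  imports Complex_Main
begin

locale bihom_algebra = vector_space scale
  for scale :: "'k::field_char_0 \<Rightarrow> 'a::ab_group_add \<Rightarrow> 'a" (infixr \<open>*s\<close> 75) +
  fixes mult :: "'a \<Rightarrow> 'a \<Rightarrow> 'a"
    and \<alpha> \<beta> :: "'a \<Rightarrow> 'a"
  assumes linear_mult_left: "Vector_Spaces.linear scale scale (\<lambda>x. mult x y)"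
    and linear_mult_right: "Vector_Spaces.linear scale scale (\<lambda>y. mult x y)"
    and linear_alpha: "Vector_Spaces.linear scale scale \<alpha>"
    and linear_beta: "Vector_Spaces.linear scale scale \<beta>"
    and alpha_beta_commute: "\<alpha> \<circ> \<beta> = \<beta> \<circ> \<alpha>"

locale regular_bihom_algebra = bihom_algebra +
  assumes bij_alpha: "bij \<alpha>"
    and bij_beta: "bij \<beta>"

locale multiplicative_bihom_algebra = bihom_algebra +
  assumes alpha_mult: "\<alpha> (mult x y) = mult (\<alpha> x) (\<alpha> y)"
    and beta_mult: "\<beta> (mult x y) = mult (\<beta> x) (\<beta> y)"

definition bihom_associator ::
  "('a::ab_group_add \<Rightarrow> 'a \<Rightarrow> 'a) \<Rightarrow> ('a \<Rightarrow> 'a) \<Rightarrow> ('a \<Rightarrow> 'a) \<Rightarrow> 'a \<Rightarrow> 'a \<Rightarrow> 'a \<Rightarrow> 'a"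
  where "bihom_associator mult \<alpha> \<beta> x y z = mult (mult x y) (\<beta> z) - mult (\<alpha> x) (mult y z)"

locale bihom_alternative_algebra = bihom_algebra +
  assumes left_alternative:
      "bihom_associator mult \<alpha> \<beta> (\<beta> x) (\<alpha> y) z + bihom_associator mult \<alpha> \<beta> (\<beta> y) (\<alpha> x) z = 0"
    and right_alternative:
      "bihom_associator mult \<alpha> \<beta> x (\<beta> y) (\<alpha> z) + bihom_associator mult \<alpha> \<beta> x (\<beta> z) (\<alpha> y) = 0"

definition bihom_jacobiator ::
  "('a::ab_group_add \<Rightarrow> 'a \<Rightarrow> 'a) \<Rightarrow> ('a \<Rightarrow> 'a) \<Rightarrow> ('a \<Rightarrow> 'a) \<Rightarrow> 'a \<Rightarrow> 'a \<Rightarrow> 'a \<Rightarrow> 'a"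
  where "bihom_jacobiator br \<alpha> \<beta> x y z =
      br (\<beta> (\<beta> x)) (br (\<beta> y) (\<alpha> z))
    + br (\<beta> (\<beta> y)) (br (\<beta> z) (\<alpha> x))
    + br (\<beta> (\<beta> z)) (br (\<beta> x) (\<alpha> y))"

locale bihom_malcev_algebra = bihom_algebra scale br \<alpha> \<beta>
  for scale :: "'k::field_char_0 \<Rightarrow> 'a::ab_group_add \<Rightarrow> 'a" (infixr \<open>*s\<close> 75)
    and br :: "'a \<Rightarrow> 'a \<Rightarrow> 'a"
    and \<alpha> \<beta> :: "'a \<Rightarrow> 'a" +
  assumes bihom_skew_symmetry: "br (\<beta> x) (\<alpha> y) = - br (\<beta> y) (\<alpha> x)"
    and bihom_malcev_identity:
      "bihom_jacobiator br \<alpha> \<beta> (\<alpha> (\<beta> x)) (\<alpha> (\<beta> y)) (br (\<beta> x) (\<alpha> z))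
        = br (bihom_jacobiator br \<alpha> \<beta> (\<beta> x) (\<beta> y) (\<beta> z)) (\<alpha> (\<alpha> (\<beta> (\<beta> x))))"

(* Meaningful only when alpha and beta are bijective: inv is an arbitrary choice otherwise. *)
definition bihom_commutator ::
  "('a::ab_group_add \<Rightarrow> 'a \<Rightarrow> 'a) \<Rightarrow> ('a \<Rightarrow> 'a) \<Rightarrow> ('a \<Rightarrow> 'a) \<Rightarrow> 'a \<Rightarrow> 'a \<Rightarrow> 'a"
  where "bihom_commutator mult \<alpha> \<beta> x y = mult x y - mult (inv \<alpha> (\<beta> y)) (\<alpha> (inv \<beta> x))"

end

theory Submission
  imports Defs
begin

text \<open>
  The twisting maps can be removed. Since \<open>\<alpha>\<close> and \<open>\<beta>\<close> are commuting automorphisms of \<open>mult\<close>, put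
  \<open>x \<cdot> y = mult (\<alpha>\<^sup>-\<^sup>1 x) (\<beta>\<^sup>-\<^sup>1 y)\<close>, so that \<open>mult x y = \<alpha> x \<cdot> \<beta> y\<close>. Both maps are automorphisms of
  \<open>\<cdot>\<close> too, and the BiHom-associator of \<open>x, y, z\<close> is the ordinary associator for \<open>\<cdot>\<close> of
  \<open>\<alpha>\<^sup>2 x, \<alpha> (\<beta> y), \<beta>\<^sup>2 z\<close>. As the maps are surjective, the BiHom-alternative laws say exactly
  that \<open>\<cdot>\<close> is alternative. Write \<open>{a, b} = a \<cdot> b - b \<cdot> a\<close>. The BiHom-commutator of \<open>x, y\<close> is
  \<open>{\<alpha> x, \<beta> y}\<close>, and its BiHom-Jacobiator of \<open>x, y, z\<close> is \<open>J (\<alpha> (\<beta>\<^sup>2 x)) (\<alpha> (\<beta>\<^sup>2 y)) (\<alpha> (\<beta>\<^sup>2 z))\<close>,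
  where \<open>J a b c\<close> is the cyclic sum of \<open>{a, {b, c}}\<close>. The BiHom-Malcev identity is therefore the
  classical Malcev identity \<open>J a b {a, c} = {J a b c, a}\<close> at the images of \<open>x, y, z\<close> under
  \<open>\<alpha>\<^sup>2 \<beta>\<^sup>3\<close>.

  The classical identity holds because the associator \<open>(a, b, c)\<close> of an alternative product is an
  alternating function, so that expanding the cyclic sum gives \<open>J a b c = - 6 (a, b, c)\<close>. It remains to
  see \<open>(a, b, {a, c}) = {(a, b, c), a}\<close>, which is the difference of the two identities
  \<open>(a, b, a \<cdot> c) = (a, b, c) \<cdot> a\<close> and \<open>(a, b, c \<cdot> a) = a \<cdot> (a, b, c)\<close>. These follow from the
  Teichmueller identity, which is valid for every biadditive product, by specialising two of its
  four arguments to \<open>a\<close> and using that the associator alternates.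
\<close>

section \<open>Alternative products and the Malcev identity\<close>

locale biadditive_product =
  fixes prod :: "'a::ab_group_add \<Rightarrow> 'a \<Rightarrow> 'a"  (infixl \<open>\<bullet>\<close> 70)
  assumes add_left: "(x + y) \<bullet> z = x \<bullet> z + y \<bullet> z"
    and add_right: "x \<bullet> (y + z) = x \<bullet> y + x \<bullet> z"
begin

lemma zero_left [simp]: "0 \<bullet> x = 0"
  using add_left[of 0 0 x] by simp

lemma zero_right [simp]: "x \<bullet> 0 = 0"
  using add_right[of x 0 0] by simp

lemma minus_left: "(- x) \<bullet> y = - (x \<bullet> y)"
  using add_left[of x "- x" y] by (simp add: eq_neg_iff_add_eq_0 add.commute)

lemma minus_right: "x \<bullet> (- y) = - (x \<bullet> y)"
  using add_right[of x y "- y"] by (simp add: eq_neg_iff_add_eq_0 add.commute)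

lemma diff_left: "(x - y) \<bullet> z = x \<bullet> z - y \<bullet> z"
  using add_left[of x "- y" z] by (simp add: minus_left)

lemma diff_right: "x \<bullet> (y - z) = x \<bullet> y - x \<bullet> z"
  using add_right[of x y "- z"] by (simp add: minus_right)

lemmas expand_products = add_left add_right minus_left minus_right diff_left diff_right

definition associator :: "'a \<Rightarrow> 'a \<Rightarrow> 'a \<Rightarrow> 'a"
  where "associator x y z = (x \<bullet> y) \<bullet> z - x \<bullet> (y \<bullet> z)"

definition commutator :: "'a \<Rightarrow> 'a \<Rightarrow> 'a"
  where "commutator x y = x \<bullet> y - y \<bullet> x"

definition jacobiator :: "'a \<Rightarrow> 'a \<Rightarrow> 'a \<Rightarrow> 'a"
  where "jacobiator x y z = commutator x (commutator y z) + commutator y (commutator z x)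
    + commutator z (commutator x y)"

lemma associator_diff_right: "associator x y (z - w) = associator x y z - associator x y w"
  by (simp add: associator_def expand_products algebra_simps)

lemma commutator_add_left: "commutator (x + y) z = commutator x z + commutator y z"
  by (simp add: commutator_def expand_products algebra_simps)

lemma commutator_minus_left: "commutator (- x) y = - commutator x y"
  by (simp add: commutator_def expand_products)

text \<open>Each of the five terms is the difference of two bracketings of \<open>w, x, y, z\<close> that are adjacent in
  the associativity pentagon; going once around the pentagon, the differences cancel.\<close>

lemma teichmueller_identity:
  "associator (w \<bullet> x) y z - associator w (x \<bullet> y) z + associator w x (y \<bullet> z)
    = w \<bullet> associator x y z + associator w x y \<bullet> z"
  by (simp add: associator_def expand_products algebra_simps)

lemma jacobiator_eq_associators:
  "jacobiator x y z =
    - (associator x y z + associator y z x + associator z x y)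
    + (associator x z y + associator y x z + associator z y x)"
  by (simp add: jacobiator_def commutator_def associator_def expand_products algebra_simps)

end

text \<open>The alternative laws are required in the form of vanishing on equal arguments, which is the
  form that is substituted into the Teichmueller identity; the linearised form only implies it in
  the absence of 2-torsion.\<close>

locale alternative_product = biadditive_product +
  assumes associator_same_left: "associator x x y = 0"
    and associator_same_right: "associator x y y = 0"
begin

lemma associator_swap_left: "associator y x z = - associator x y z"
proof -
  have "associator (x + y) (x + y) z
      = associator x x z + associator x y z + associator y x z + associator y y z"
    by (simp add: associator_def expand_products algebra_simps)
  then show ?thesis
    by (simp add: associator_same_left eq_neg_iff_add_eq_0 add.commute)
qed

lemma associator_swap_right: "associator x z y = - associator x y z"
proof -
  have "associator x (y + z) (y + z)
      = associator x y y + associator x y z + associator x z y + associator x z z"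
    by (simp add: associator_def expand_products algebra_simps)
  then show ?thesis
    by (simp add: associator_same_right eq_neg_iff_add_eq_0 add.commute)
qed

lemma associator_swap_outer: "associator z y x = - associator x y z"
  by (metis associator_swap_left associator_swap_right)

lemma associator_rotate: "associator y z x = associator x y z"
  by (metis associator_swap_left associator_swap_right)

lemma associator_same_outer: "associator x y x = 0"
  by (metis associator_swap_left associator_same_right neg_equal_0_iff_equal)

text \<open>The next two lemmas come from the Teichmueller identity at \<open>x, x, y, z\<close> and at \<open>z, y, x, x\<close>. They
  trade the same term for one with a factor \<open>x\<close> to the left, respectively to the right, of the middle
  argument; once one of these two middle terms is known, comparing the lemmas gives the other.\<close>

lemma associator_square_left:
  "associator (x \<bullet> x) y z = associator x (x \<bullet> y) z + x \<bullet> associator x y z"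
  using teichmueller_identity[of x x y z] by (simp add: associator_same_left algebra_simps)

lemma associator_square_right:
  "associator (x \<bullet> x) y z = associator x (y \<bullet> x) z + associator x y z \<bullet> x"
proof -
  have "associator z y (x \<bullet> x) = associator z (y \<bullet> x) x + associator z y x \<bullet> x"
    using teichmueller_identity[of z y x x] by (simp add: associator_same_right algebra_simps)
  then show ?thesis
    by (simp add: associator_swap_outer[of z _ x] associator_swap_outer[of z _ "x \<bullet> x"]
        minus_left algebra_simps)
qed

text \<open>Since \<open>associator (x \<bullet> x) y z\<close> changes sign when \<open>y\<close> and \<open>z\<close> are exchanged,
  \<open>associator_square_left\<close> can be read with the factor \<open>x\<close> attached to \<open>y\<close> or to \<open>z\<close>.\<close>

lemma associator_mult_left_shift: "associator x (x \<bullet> y) z = associator x y (x \<bullet> z)"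
proof -
  have "associator (x \<bullet> x) z y = associator x (x \<bullet> z) y + x \<bullet> associator x z y"
    by (rule associator_square_left)
  then have "associator (x \<bullet> x) y z = associator x y (x \<bullet> z) + x \<bullet> associator x y z"
    by (simp add: associator_swap_right[of _ y] minus_right algebra_simps)
  then show ?thesis
    using associator_square_left[of x y z] by simp
qed

text \<open>In the Teichmueller identity at \<open>x, y, x, z\<close> the first term on the left is
  \<open>- associator x (x \<bullet> y) z\<close> and the third is \<open>associator x y (x \<bullet> z)\<close>; they cancel by the
  preceding lemma.\<close>

lemma associator_middle_mult_right: "associator x (y \<bullet> x) z = x \<bullet> associator x y z"
proof -
  have "associator (x \<bullet> y) x z - associator x (y \<bullet> x) z + associator x y (x \<bullet> z)
      = x \<bullet> associator y x z + associator x y x \<bullet> z"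
    by (rule teichmueller_identity)
  then show ?thesis
    by (simp add: associator_same_outer associator_swap_left[of _ x] associator_mult_left_shift
        minus_right)
qed

lemma associator_middle_mult_left: "associator x (x \<bullet> y) z = associator x y z \<bullet> x"
  using associator_square_left[of x y z] associator_square_right[of x y z]
  by (simp add: associator_middle_mult_right add.commute)

lemma associator_commutator: "associator x y (commutator x z) = commutator (associator x y z) x"
proof -
  have "associator x y (x \<bullet> z) = associator x y z \<bullet> x"
    by (metis associator_mult_left_shift associator_middle_mult_left)
  moreover have "associator x y (z \<bullet> x) = x \<bullet> associator x y z"
    by (metis associator_swap_right associator_middle_mult_right minus_right)
  ultimately show ?thesis
    by (simp add: commutator_def associator_diff_right)
qed

text \<open>By alternation the three cyclic associators agree and the other three are their negatives, so
  all six terms contribute the same summand.\<close>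

lemma jacobiator_eq_associator:
  "jacobiator x y z = - (associator x y z + associator x y z + associator x y z
    + associator x y z + associator x y z + associator x y z)"
  unfolding jacobiator_eq_associators
  using associator_rotate[of x y z] associator_rotate[of z x y] associator_swap_left[of y x z]
    associator_swap_right[of x z y] associator_swap_outer[of z y x]
  by (simp add: algebra_simps)

theorem malcev_identity: "jacobiator x y (commutator x z) = commutator (jacobiator x y z) x"
  by (simp only: jacobiator_eq_associator associator_commutator commutator_minus_left
      commutator_add_left)

end

section \<open>Untwisting a regular BiHom-alternative algebra\<close>

locale regular_bihom_alternative_algebra =
  multiplicative_bihom_algebra + regular_bihom_algebra + bihom_alternative_algebra
begin

lemma double_eq_zero:
  fixes x :: 'b
  assumes "x + x = 0"
  shows "x = 0"
proof -
  have "scale 2 x = x + x"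
    by (metis scale_left_distrib scale_one one_add_one)
  with assms have "scale 2 x = 0"
    by simp
  then show ?thesis
    by simp
qed

lemma alpha_beta: "\<alpha> (\<beta> x) = \<beta> (\<alpha> x)"
  using alpha_beta_commute by (metis comp_apply)

lemma inv_alpha_alpha [simp]: "inv \<alpha> (\<alpha> x) = x"
  using bij_alpha by (simp add: bij_is_inj)

lemma alpha_inv_alpha [simp]: "\<alpha> (inv \<alpha> x) = x"
  using bij_alpha by (simp add: bij_is_surj surj_f_inv_f)

lemma inv_beta_beta [simp]: "inv \<beta> (\<beta> x) = x"
  using bij_beta by (simp add: bij_is_inj)

lemma beta_inv_beta [simp]: "\<beta> (inv \<beta> x) = x"
  using bij_beta by (simp add: bij_is_surj surj_f_inv_f)

lemma alpha_inv_beta: "\<alpha> (inv \<beta> x) = inv \<beta> (\<alpha> x)"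
  by (metis alpha_beta inv_beta_beta beta_inv_beta)

lemma beta_inv_alpha: "\<beta> (inv \<alpha> x) = inv \<alpha> (\<beta> x)"
  by (metis alpha_beta inv_alpha_alpha alpha_inv_alpha)

lemma linear_inv_alpha: "Vector_Spaces.linear scale scale (inv \<alpha>)"
proof -
  have add: "\<alpha> (x + y) = \<alpha> x + \<alpha> y" and scale: "\<alpha> (scale c x) = scale c (\<alpha> x)" for x y c
    using linear_alpha by (simp_all add: Vector_Spaces.linear_iff)
  show ?thesis
    unfolding Vector_Spaces.linear_iff
    using vector_space_axioms add scale by (metis inv_alpha_alpha alpha_inv_alpha)
qed

lemma linear_inv_beta: "Vector_Spaces.linear scale scale (inv \<beta>)"
proof -
  have add: "\<beta> (x + y) = \<beta> x + \<beta> y" and scale: "\<beta> (scale c x) = scale c (\<beta> x)" for x y c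
    using linear_beta by (simp_all add: Vector_Spaces.linear_iff)
  show ?thesis
    unfolding Vector_Spaces.linear_iff
    using vector_space_axioms add scale by (metis inv_beta_beta beta_inv_beta)
qed

lemmas linear_maps = linear_alpha linear_beta linear_inv_alpha linear_inv_beta
  linear_mult_left linear_mult_right

lemmas linear_map_simps = linear_maps[unfolded Vector_Spaces.linear_iff, THEN conjunct2,
    THEN conjunct2, THEN conjunct1, rule_format]
  linear_maps[unfolded Vector_Spaces.linear_iff, THEN conjunct2,
    THEN conjunct2, THEN conjunct2, rule_format]

definition untwisted_mult :: "'b \<Rightarrow> 'b \<Rightarrow> 'b"
  where "untwisted_mult x y = mult (inv \<alpha> x) (inv \<beta> y)"

lemma mult_eq_untwisted: "mult x y = untwisted_mult (\<alpha> x) (\<beta> y)"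
  by (simp add: untwisted_mult_def)

lemma alpha_untwisted_mult: "\<alpha> (untwisted_mult x y) = untwisted_mult (\<alpha> x) (\<alpha> y)"
  by (simp add: untwisted_mult_def alpha_mult alpha_inv_beta)

lemma beta_untwisted_mult: "\<beta> (untwisted_mult x y) = untwisted_mult (\<beta> x) (\<beta> y)"
  by (simp add: untwisted_mult_def beta_mult beta_inv_alpha)

sublocale untwisted: biadditive_product untwisted_mult
  by unfold_locales (simp_all add: untwisted_mult_def linear_map_simps)

lemma bihom_associator_eq_untwisted:
  "bihom_associator mult \<alpha> \<beta> x y z = untwisted.associator (\<alpha> (\<alpha> x)) (\<alpha> (\<beta> y)) (\<beta> (\<beta> z))"
  by (simp add: bihom_associator_def untwisted.associator_def mult_eq_untwisted
      alpha_untwisted_mult beta_untwisted_mult alpha_beta)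

sublocale untwisted: alternative_product untwisted_mult
proof
  fix x y :: 'b
  \<comment> \<open>The arguments are chosen so that the twists in the left, respectively right, alternative law
    turn them into \<open>x, x, y\<close>, respectively \<open>x, y, y\<close>.\<close>
  define u where "u = inv \<beta> (inv \<alpha> (inv \<alpha> x))"
  have u: "\<alpha> (\<alpha> (\<beta> u)) = x" "\<alpha> (\<beta> (\<alpha> u)) = x"
    by (simp_all add: u_def alpha_beta[symmetric] alpha_inv_beta beta_inv_alpha)
  show "untwisted.associator x x y = 0"
    using left_alternative[of u u "inv \<beta> (inv \<beta> y)"]
    by - (rule double_eq_zero, simp add: bihom_associator_eq_untwisted u)
  define v where "v = inv \<beta> (inv \<beta> (inv \<alpha> y))"
  have v: "\<alpha> (\<beta> (\<beta> v)) = y" "\<beta> (\<beta> (\<alpha> v)) = y"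
    by (simp_all add: v_def alpha_beta[symmetric] alpha_inv_beta beta_inv_alpha)
  show "untwisted.associator x y y = 0"
    using right_alternative[of "inv \<alpha> (inv \<alpha> x)" v v]
    by - (rule double_eq_zero, simp add: bihom_associator_eq_untwisted v)
qed

lemma alpha_untwisted_commutator:
  "\<alpha> (untwisted.commutator x y) = untwisted.commutator (\<alpha> x) (\<alpha> y)"
  by (simp add: untwisted.commutator_def
      module_hom.diff[OF linear_alpha[unfolded linear_iff_module_hom]] alpha_untwisted_mult)

lemma beta_untwisted_commutator:
  "\<beta> (untwisted.commutator x y) = untwisted.commutator (\<beta> x) (\<beta> y)"
  by (simp add: untwisted.commutator_def
      module_hom.diff[OF linear_beta[unfolded linear_iff_module_hom]] beta_untwisted_mult)

lemma alpha_untwisted_jacobiator: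
  "\<alpha> (untwisted.jacobiator x y z) = untwisted.jacobiator (\<alpha> x) (\<alpha> y) (\<alpha> z)"
  by (simp add: untwisted.jacobiator_def linear_map_simps alpha_untwisted_commutator)

text \<open>The factors \<open>\<alpha>\<^sup>-\<^sup>1 \<beta>\<close> and \<open>\<alpha> \<beta>\<^sup>-\<^sup>1\<close> in the BiHom-commutator are the ones that make the second
  product the untwisted product of \<open>\<beta> y\<close> and \<open>\<alpha> x\<close>.\<close>

lemma bihom_commutator_eq_untwisted:
  "bihom_commutator mult \<alpha> \<beta> x y = untwisted.commutator (\<alpha> x) (\<beta> y)"
  by (simp add: bihom_commutator_def untwisted.commutator_def untwisted_mult_def alpha_inv_beta)

lemma bihom_jacobiator_eq_untwisted:
  "bihom_jacobiator (bihom_commutator mult \<alpha> \<beta>) \<alpha> \<beta> x y z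
    = untwisted.jacobiator (\<alpha> (\<beta> (\<beta> x))) (\<alpha> (\<beta> (\<beta> y))) (\<alpha> (\<beta> (\<beta> z)))"
  by (simp add: bihom_jacobiator_def untwisted.jacobiator_def bihom_commutator_eq_untwisted
      alpha_untwisted_commutator beta_untwisted_commutator alpha_beta)

lemma bihom_malcev_bihom_commutator:
  "bihom_malcev_algebra scale (bihom_commutator mult \<alpha> \<beta>) \<alpha> \<beta>"
proof (intro bihom_malcev_algebra.intro bihom_algebra.intro bihom_algebra_axioms.intro
    bihom_malcev_algebra_axioms.intro vector_space_axioms linear_alpha linear_beta
    alpha_beta_commute)
  fix x y z :: 'b
  show "Vector_Spaces.linear scale scale (\<lambda>x. bihom_commutator mult \<alpha> \<beta> x y)"
    unfolding Vector_Spaces.linear_iff bihom_commutator_def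
    using vector_space_axioms by (simp add: linear_map_simps scale_right_diff_distrib)
  show "Vector_Spaces.linear scale scale (\<lambda>y. bihom_commutator mult \<alpha> \<beta> x y)"
    unfolding Vector_Spaces.linear_iff bihom_commutator_def
    using vector_space_axioms by (simp add: linear_map_simps scale_right_diff_distrib)
  show "bihom_commutator mult \<alpha> \<beta> (\<beta> x) (\<alpha> y) = - bihom_commutator mult \<alpha> \<beta> (\<beta> y) (\<alpha> x)"
    by (simp add: bihom_commutator_eq_untwisted untwisted.commutator_def alpha_beta)
  show "bihom_jacobiator (bihom_commutator mult \<alpha> \<beta>) \<alpha> \<beta> (\<alpha> (\<beta> x)) (\<alpha> (\<beta> y))
        (bihom_commutator mult \<alpha> \<beta> (\<beta> x) (\<alpha> z))
      = bihom_commutator mult \<alpha> \<beta>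
          (bihom_jacobiator (bihom_commutator mult \<alpha> \<beta>) \<alpha> \<beta> (\<beta> x) (\<beta> y) (\<beta> z))
          (\<alpha> (\<alpha> (\<beta> (\<beta> x))))"
    by (simp add: bihom_jacobiator_eq_untwisted bihom_commutator_eq_untwisted alpha_beta
        alpha_untwisted_commutator beta_untwisted_commutator
        alpha_untwisted_jacobiator untwisted.malcev_identity)
qed

end

theorem theorem4p7:
  fixes scale :: "'k::field_char_0 \<Rightarrow> 'a::ab_group_add \<Rightarrow> 'a"
    and mult :: "'a \<Rightarrow> 'a \<Rightarrow> 'a"
    and \<alpha> \<beta> :: "'a \<Rightarrow> 'a"
  assumes "multiplicative_bihom_algebra scale mult \<alpha> \<beta>"
    and "regular_bihom_algebra scale mult \<alpha> \<beta>"
    and "bihom_alternative_algebra scale mult \<alpha> \<beta>"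
  shows "bihom_malcev_algebra scale (bihom_commutator mult \<alpha> \<beta>) \<alpha> \<beta>"
proof -
  interpret regular_bihom_alternative_algebra scale mult \<alpha> \<beta>
    using assms by (rule regular_bihom_alternative_algebra.intro)
  show ?thesis
    by (rule bihom_malcev_bihom_commutator)
qed

end
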